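(* Let $\alpha>2$, $\lambda_e>0$ and $R_s>0$, and put $\beta_t=2^{R_s}-1$. Consider a multihop path $L$ with $|L|$ hops. For each hop $n\in\{1,\dots,|L|\}$, let $p_n>0$ be the transmit power, $|D_n|>0$ the distance between the transmitter and the receiver of hop $n$, and $H_n$ the fading gain of that link; let $\Phi_{ne}$ be a homogeneous Poisson point process of density $\lambda_e$ in $\mathbb{R}^2$ (eavesdropper locations of hop $n$), and for each $e\in\Phi_{ne}$ let $|X_{ne}|$ be its distance from the transmitter of hop $n$ and $S_{ne}$ its fading gain. Assume all $H_n$, $S_{ne}$ are i.i.d. exponential with unit mean, independent of the point processes, and that all these random objects are independent across hops. Define $$\mathtt{SNR}_n=\frac{p_nH_n}{|D_n|^\alpha},\qquad \mathtt{SNR}^{\rm sum}_{ne}=\sum_{e\in\Phi_{ne}}\frac{p_nS_{ne}}{|X_{ne}|^\alpha},$$ the per-hop secrecy outage probability $$\mathcal{P}'_{{\rm so},n}=\mathcal{P}\left(\log_2\frac{1+\mathtt{SNR}_n}{1+\mathtt{SNR}^{\rm sum}_{ne}}<R_s\;\Big|\;\mathtt{SNR}_n>\beta_t\right),$$ and the end-to-end secrecy outage probability $\mathcal{P}_{\rm so}=1-\prod_{n=1}^{|L|}\left(1-\mathcal{P}'_{{\rm so},n}\right)$. Then $$\mathcal{P}_{\rm so}=1-\exp\left[-K_1\,2^{\frac{2R_s}{\alpha}}\sum_{n=1}^{|L|}|D_n|^2\right],\qquad K_1=\pi\lambda_e\,\Gamma\!\left(1+\tfrac{2}{\alpha}\right)\Gamma\!\left(1-\tfrac{2}{\alpha}\right),$$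 where $\Gamma$ is the gamma function.
   Context: Model: secure multihop transmission with randomize-and-forward relaying, where each hop is transmitted in a separate slot and eavesdroppers within a hop collude (their SNRs add), but eavesdroppers cannot combine information across hops. The path-loss exponent is $\alpha$; channels combine path loss $|{\rm distance}|^{-\alpha}$ with Rayleigh fading (unit-mean exponential power gains). *)

theory Defs
  imports "HOL-Probability.Probability"
begin

type_synonym point = "real \<times> real"

definition pp_count :: "(nat \<Rightarrow> 'a \<Rightarrow> point) \<Rightarrow> point set \<Rightarrow> 'a \<Rightarrow> nat" where
  "pp_count X A w = card {k. X k w \<in> A}"

text \<open>Homogeneous Poisson point process of intensity lam on the plane, given by an
  enumeration X 0, X 1, ... of its (distinct) points: each X k is a random point,
  the enumeration has no repetitions almost surely, every bounded Borel set
  contains a.s. finitely many points whose number is Poisson with mean lam times its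
  area, and the counts in pairwise disjoint bounded Borel sets are independent.\<close>
definition homogeneous_PPP :: "'a measure \<Rightarrow> real \<Rightarrow> (nat \<Rightarrow> 'a \<Rightarrow> point) \<Rightarrow> bool" where
  "homogeneous_PPP M lam X \<longleftrightarrow>
     (\<forall>k. X k \<in> borel_measurable M) \<and>
     (AE w in M. inj (\<lambda>k. X k w)) \<and>
     (\<forall>A. A \<in> sets borel \<and> bounded A \<longrightarrow>
        (AE w in M. finite {k. X k w \<in> A}) \<and>
        (\<forall>j::nat. measure M {w \<in> space M. pp_count X A w = j} =
            (lam * measure lborel A) ^ j / fact j * exp (- (lam * measure lborel A)))) \<and>
     (\<forall>(F :: nat \<Rightarrow> point set) m.
        (\<forall>i<m. F i \<in> sets borel \<and> bounded (F i)) \<and> disjoint_family_on F {..<m} \<longrightarrow>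
        prob_space.indep_vars M (\<lambda>_. count_space UNIV) (\<lambda>i w. pp_count X (F i) w) {..<m})"

text \<open>Independence of two random variables with possibly different codomains
  (what indep_var unfolds to, but without forcing a common codomain type).\<close>
definition indep_rv2 :: "'a measure \<Rightarrow> 'b measure \<Rightarrow> ('a \<Rightarrow> 'b) \<Rightarrow> 'c measure \<Rightarrow> ('a \<Rightarrow> 'c) \<Rightarrow> bool" where
  "indep_rv2 M Ma A Mb B \<longleftrightarrow>
     A \<in> measurable M Ma \<and> B \<in> measurable M Mb \<and>
     prob_space.indep_set M {A -` E \<inter> space M |E. E \<in> sets Ma} {B -` E \<inter> space M |E. E \<in> sets Mb}"

end

(* Write s = 2^Rs * d^alpha for a hop of length d and I for the shot noise
   sum_k S_k / |X_k - T|^alpha. Given SNR > beta_t, secrecy means H >= beta_t d^alpha / p + s I, so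
   by the memoryless exponential tail its conditional probability is E exp(-s I). Averaging over
   the fading turns this into E exp(-sum_k ln (1 + s / |X_k - T|^alpha)), which the Laplace
   functional of the Poisson process evaluates as exp(-lam * integral of s / (s + |x - T|^alpha)).
   The level sets of the integrand are discs, so the layer-cake formula reduces that integral to
   the Beta integral pi s^(2/alpha) B(1 - 2/alpha, 1 + 2/alpha). *)
theory Submission
  imports Defs
begin

section \<open>The Laplace functional of a Poisson point process\<close>

text \<open>The conditioning is harmless: the requirement SNR > beta_t contributes the same
  exponential factor to the joint probability and to the conditioning event, so it cancels. The
  power cancels too, since it scales both SNRs alike. The Poisson hypothesis only gives the joint
  law of counts in disjoint bounded sets. The Laplace functional is therefore built from simple
  functions with bounded support and extended by monotone limits. The exponent alpha > 2 is what
  makes the path loss integral finite: far from T the integrand behaves like s |x - T|^(-alpha),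
  which is integrable in the plane only for alpha > 2, while near T it stays below 1, so the
  singularity of the path loss does no damage. After the layer-cake step the same condition reads 1
  - 2/alpha > 0, the convergence of the Beta integral at t = 0.\<close>

text \<open>Working with exp(-y) on the extended half line, with value 0 at infinity, lets all
  expectations be taken before the almost sure convergence of the shot noise is known.\<close>
definition expn :: "ennreal \<Rightarrow> ennreal" where
  "expn y = (if y = \<top> then 0 else ennreal (exp (- enn2real y)))"

lemma expn_ennreal [simp]: "0 \<le> x \<Longrightarrow> expn (ennreal x) = ennreal (exp (- x))"
  by (simp add: expn_def)

lemma expn_top [simp]: "expn \<top> = 0"
  by (simp add: expn_def)

lemma expn_0 [simp]: "expn 0 = 1"
  by (simp add: expn_def)

lemma measurable_expn [measurable]: "expn \<in> borel_measurable borel"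
  unfolding expn_def by measurable

lemma expn_le_1: "expn y \<le> 1"
  by (cases y) auto

lemma expn_add: "expn (x + y) = expn x * expn y"
  by (cases x; cases y) (auto simp flip: ennreal_plus ennreal_mult simp: exp_add exp_diff exp_minus field_simps)

lemma expn_sum: "expn (sum f A) = (\<Prod>i\<in>A. expn (f i))"
  by (induction A rule: infinite_finite_induct) (auto simp: expn_add)

lemma expn_antimono: "x \<le> y \<Longrightarrow> expn y \<le> expn x"
  by (cases x; cases y) (auto simp: ennreal_le_iff top_unique)

text \<open>Continuity including the point at infinity. At a finite limit \<open>f\<close> is
  eventually finite and the real exponential takes over; at \<open>\<top>\<close>, once
  \<open>f x\<close> exceeds |ln r| the value drops below \<open>r\<close>.\<close>

lemma tendsto_expn:
  assumes "(f \<longlongrightarrow> l) F"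
  shows "((\<lambda>x. expn (f x)) \<longlongrightarrow> expn l) F"
proof (cases "l = \<top>")
  case False
  then obtain r where r: "l = ennreal r" "r \<ge> 0" by (cases l) auto
  have ev: "eventually (\<lambda>x. f x < \<top>) F"
    using order_tendstoD(2)[OF assms, of \<top>] r by simp
  have "((\<lambda>x. enn2real (f x)) \<longlongrightarrow> r) F"
    using tendsto_enn2real[OF assms[unfolded r(1)]] r by simp
  then have "((\<lambda>x. ennreal (exp (- enn2real (f x)))) \<longlongrightarrow> ennreal (exp (- r))) F"
    by (intro tendsto_ennrealI tendsto_exp tendsto_minus)
  then show ?thesis
    unfolding r(1) expn_ennreal[OF r(2)]
    by (rule Lim_transform_eventually) (use ev in eventually_elim, auto simp: expn_def)
next
  case True
  show ?thesis
  proof (rule order_tendstoI)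
    fix e assume "expn l < e"
    then obtain r where r: "0 < r" "ennreal r \<le> e"
      using True by (cases e) (auto intro: that[of 1])
    have "eventually (\<lambda>x. ennreal \<bar>ln r\<bar> < f x) F"
      using order_tendstoD(1)[OF assms, of "ennreal \<bar>ln r\<bar>"] True by simp
    then show "eventually (\<lambda>x. expn (f x) < e) F"
    proof eventually_elim
      case (elim x)
      have "expn (f x) < ennreal r"
      proof (cases "f x")
        case (real s)
        then have "- s < ln r" using elim by (auto simp: ennreal_less_iff)
        then have "exp (- s) < r" using r exp_less_cancel_iff[of "- s" "ln r"] by simp
        then show ?thesis using real r by (auto simp: ennreal_less_iff)
      qed (use r in auto)
      then show ?case using r by order
    qed
  qed (use True in auto)
qed

text \<open>This is the Poisson generating function evaluated at exp(-c), obtained by splitting the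
  expectation over the countably many values of \<open>Y\<close>.\<close>

lemma (in prob_space) nn_integral_expn_poisson:
  assumes [measurable]: "Y \<in> measurable M (count_space UNIV)"
    and P: "\<And>j::nat. measure M {w \<in> space M. Y w = j} = mu ^ j / fact j * exp (- mu)"
    and mu: "mu \<ge> 0" and c: "c \<ge> 0"
  shows "(\<integral>\<^sup>+w. expn (ennreal c * of_nat (Y w)) \<partial>M) = ennreal (exp (- (mu * (1 - exp (- c)))))"
proof -
  have "(\<integral>\<^sup>+w. expn (ennreal c * of_nat (Y w)) \<partial>M)
      = (\<integral>\<^sup>+w. (\<Sum>j. expn (ennreal c * of_nat j) * indicator {w \<in> space M. Y w = j} w) \<partial>M)"
  proof (rule nn_integral_cong)
    fix w assume w: "w \<in> space M"
    show "expn (ennreal c * of_nat (Y w)) = (\<Sum>j. expn (ennreal c * of_nat j) * indicator {w \<in> space M. Y w = j} w)"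
      using w by (subst suminf_finite[of "{Y w}"]) auto
  qed
  also have "\<dots> = (\<Sum>j. expn (ennreal c * of_nat j) * emeasure M {w \<in> space M. Y w = j})"
    by (subst nn_integral_suminf) (auto simp: nn_integral_cmult_indicator)
  \<comment> \<open>Factoring out exp(-mu) leaves the exponential series at mu * exp(-c).\<close>
  also have "\<dots> = (\<Sum>j. ennreal (exp (- mu) * ((mu * exp (- c)) ^ j /\<^sub>R fact j)))"
    using c mu
    by (intro suminf_cong)
       (auto simp: emeasure_eq_measure P ennreal_of_nat_eq_real_of_nat power_mult_distrib
          divide_inverse mult_ac simp flip: ennreal_mult exp_of_nat_mult)
  also have "\<dots> = ennreal (exp (- mu) * exp (mu * exp (- c)))"
    by (intro suminf_ennreal_eq sums_mult exp_converges) (use mu in auto)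
  finally show ?thesis
    by (simp add: algebra_simps flip: exp_add)
qed

text \<open>Puts a truncated simple function into the form that \<open>homogeneous_PPP\<close> can
  handle: finitely many disjoint sets, indexed by naturals, that inherit boundedness from
  \<open>B\<close>.\<close>

lemma simple_function_disjoint_level_sets:
  fixes f :: "'b \<Rightarrow> ennreal"
  assumes "simple_function M f" "\<And>x. f x < \<top>" "B \<in> sets M" "space M = UNIV"
  obtains m :: nat and c :: "nat \<Rightarrow> real" and F where
    "\<And>i. c i \<ge> 0" "\<And>i. F i \<in> sets M" "\<And>i. F i \<subseteq> B" "disjoint_family_on F {..<m}"
    "\<And>x. f x * indicator B x = (\<Sum>i<m. ennreal (c i) * indicator (F i) x)"
proof -
  define V where "V = range f"
  have fin: "finite V" using assms by (auto simp: simple_function_def V_def)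
  obtain e where e: "bij_betw e {..<card V} V"
    using ex_bij_betw_nat_finite[OF fin] by (auto simp: atLeast0LessThan)
  define F where "F i = (f -` {e i} \<inter> space M) \<inter> B" for i
  define c where "c i = enn2real (e i)" for i
  show ?thesis
  proof (rule that[of c F "card V"])
    show "F i \<in> sets M" for i
      unfolding F_def by (intro sets.Int simple_functionD(2)[OF assms(1)] assms)
    show "disjoint_family_on F {..<card V}"
      using e by (auto simp: disjoint_family_on_def F_def bij_betw_def inj_on_def)
    fix x
    obtain i0 where i0: "i0 < card V" "e i0 = f x"
      using e unfolding bij_betw_def V_def by (metis imageE lessThan_iff rangeI)
    \<comment> \<open>\<open>e\<close> is injective only below \<open>card V\<close>, so the claim
      that \<open>x\<close> lies in a single level set is restricted to those indices.\<close>
    have *: "(indicator (F i) x :: ennreal) = (if i = i0 then indicator B x else 0)" if "i < card V" for i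
      using that i0 e assms(4) by (auto simp: F_def indicator_def bij_betw_def inj_on_def)
    have "(\<Sum>i<card V. ennreal (c i) * indicator (F i) x)
        = (\<Sum>i<card V. if i = i0 then f x * indicator B x else 0)"
      by (intro sum.cong refl)
         (use * i0 assms(2)[of x] in \<open>auto simp: c_def ennreal_enn2real_if\<close>)
    then show "f x * indicator B x = (\<Sum>i<card V. ennreal (c i) * indicator (F i) x)"
      using i0 by simp
  qed (auto simp: c_def F_def)
qed

text \<open>Grouping the points by level set turns the sum into a weighted sum of counts.
  Independence of the counts factors the expectation, and each factor is a Poisson generating
  function. The exponents reassemble into an integral because 1 - exp(-c i) is the value of 1 -
  \<open>expn\<close> (f x) on \<open>F i\<close>.\<close>

lemma (in prob_space) laplace_functional_PPP_simple:
  assumes X: "homogeneous_PPP M lam X" and lam: "lam > 0"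
    and f: "simple_function borel f" "\<And>x. f x < \<top>" and B: "B \<in> sets borel" "bounded B"
  shows "(\<integral>\<^sup>+w. expn (\<Sum>k. f (X k w) * indicator B (X k w)) \<partial>M)
       = expn (ennreal lam * (\<integral>\<^sup>+x. 1 - expn (f x * indicator B x) \<partial>lborel))"
proof -
  obtain m c F where c: "\<And>i::nat. c i \<ge> (0::real)" and F: "\<And>i. F i \<in> sets borel" "\<And>i. F i \<subseteq> B"
    and disj: "disjoint_family_on F {..<m}"
    and f_eq: "\<And>x. f x * indicator B x = (\<Sum>i<m. ennreal (c i) * indicator (F i) x)"
    by (rule simple_function_disjoint_level_sets[OF f B(1)]) auto
  have bF: "bounded (F i)" for i using F B bounded_subset by blast
  have fin: "AE w in M. \<forall>i. finite {k. X k w \<in> F i}"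
    using X F bF by (auto simp: homogeneous_PPP_def AE_all_countable)
  define Nc where "Nc i = pp_count X (F i)" for i
  have ind: "indep_vars (\<lambda>_. count_space UNIV) Nc {..<m}"
    using X F bF disj unfolding homogeneous_PPP_def Nc_def
    by (metis (mono_tags, lifting) ext)
  define mu where "mu i = lam * measure lborel (F i)" for i
  have mu0: "mu i \<ge> 0" for i using lam by (simp add: mu_def)
  have pois: "measure M {w \<in> space M. Nc i w = j} = mu i ^ j / fact j * exp (- mu i)" for i j
  proof -
    have "\<forall>A. A \<in> sets borel \<and> bounded A \<longrightarrow> (\<forall>j::nat. measure M {w \<in> space M. pp_count X A w = j} =
            (lam * measure lborel A) ^ j / fact j * exp (- (lam * measure lborel A)))"
      using X unfolding homogeneous_PPP_def by blast
    then show ?thesis using F bF unfolding Nc_def mu_def by simp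
  qed
  \<comment> \<open>Boundedness makes the area finite, so the real-valued \<open>measure\<close> in
    the Poisson mean is the true area and not the default value 0.\<close>
  have emF: "emeasure lborel (F i) = ennreal (measure lborel (F i))" for i
    using F bF emeasure_bounded_finite[of "F i"] by (simp add: emeasure_eq_ennreal_measure)
  have "(\<integral>\<^sup>+w. expn (\<Sum>k. f (X k w) * indicator B (X k w)) \<partial>M)
      = (\<integral>\<^sup>+w. (\<Prod>i<m. expn (ennreal (c i) * of_nat (Nc i w))) \<partial>M)"
  proof (rule nn_integral_cong_AE, use fin in eventually_elim)
    case (elim w)
    have "(\<Sum>k. f (X k w) * indicator B (X k w)) = (\<Sum>i<m. (\<Sum>k. ennreal (c i) * indicator (F i) (X k w)))"
      unfolding f_eq by (rule suminf_sum) auto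
    also have "\<dots> = (\<Sum>i<m. ennreal (c i) * of_nat (Nc i w))"
    proof (intro sum.cong refl)
      fix i
      have "(\<Sum>k. indicator (F i) (X k w) :: ennreal) = (\<Sum>k\<in>{k. X k w \<in> F i}. indicator (F i) (X k w))"
        using elim by (intro suminf_finite) auto
      also have "\<dots> = of_nat (Nc i w)"
        by (simp add: Nc_def pp_count_def)
      finally show "(\<Sum>k. ennreal (c i) * indicator (F i) (X k w)) = ennreal (c i) * of_nat (Nc i w)"
        by simp
    qed
    finally show ?case by (simp add: expn_sum)
  qed
  also have "\<dots> = (\<Prod>i<m. \<integral>\<^sup>+w. expn (ennreal (c i) * of_nat (Nc i w)) \<partial>M)"
    by (intro indep_vars_nn_integral indep_vars_compose2[OF ind]) auto
  also have "\<dots> = (\<Prod>i<m. ennreal (exp (- (mu i * (1 - exp (- c i))))))"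
  proof (intro prod.cong refl nn_integral_expn_poisson pois c mu0)
    fix i assume "i \<in> {..<m}"
    then show "Nc i \<in> measurable M (count_space UNIV)"
      using ind by (auto simp: indep_vars_def2)
  qed
  also have "\<dots> = (\<Prod>i<m. expn (ennreal (mu i * (1 - exp (- c i)))))"
    using mu0 c by (intro prod.cong refl) auto
  also have "\<dots> = expn (\<Sum>i<m. ennreal (mu i * (1 - exp (- c i))))"
    by (simp add: expn_sum)
  also have "(\<Sum>i<m. ennreal (mu i * (1 - exp (- c i))))
      = (\<Sum>i<m. ennreal lam * (ennreal (1 - exp (- c i)) * emeasure lborel (F i)))"
    using lam c by (intro sum.cong refl) (simp add: emF mu_def mult_ac flip: ennreal_mult)
  also have "\<dots> = ennreal lam * (\<integral>\<^sup>+x. (\<Sum>i<m. ennreal (1 - exp (- c i)) * indicator (F i) x) \<partial>lborel)"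
    using F(1) by (subst nn_integral_sum) (simp_all add: nn_integral_cmult_indicator sum_distrib_left)
  also have "(\<lambda>x. \<Sum>i<m. ennreal (1 - exp (- c i)) * indicator (F i) x)
       = (\<lambda>x. 1 - expn (f x * indicator B x))"
  proof
    fix x
    show "(\<Sum>i<m. ennreal (1 - exp (- c i)) * indicator (F i) x) = 1 - expn (f x * indicator B x)"
    proof (cases "\<exists>i<m. x \<in> F i")
      case False
      then show ?thesis unfolding f_eq by simp
    next
      case True
      then obtain i0 where i0: "i0 < m" "x \<in> F i0" by auto
      have *: "(indicator (F i) x :: ennreal) = (if i = i0 then 1 else 0)" if "i < m" for i
        using that i0 disj by (auto simp: disjoint_family_on_def indicator_def)
      have **: "(\<Sum>i<m. g i * indicator (F i) x) = g i0" for g :: "nat \<Rightarrow> ennreal"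
      proof -
        have "(\<Sum>i<m. g i * indicator (F i) x) = (\<Sum>i<m. if i = i0 then g i0 else 0)"
          by (intro sum.cong refl) (use * in auto)
        then show ?thesis using i0 by simp
      qed
      show ?thesis unfolding f_eq ** using c by (simp add: ennreal_minus flip: ennreal_1)
    qed
  qed
  finally show ?thesis .
qed

text \<open>Simple approximations of \<open>f\<close> are cut off to growing balls, which gives them
  bounded support and keeps them increasing to \<open>f\<close>. On the probability side the
  constant 1 dominates; on the spatial side 1 - \<open>expn\<close> increases along the sequence, so
  monotone convergence applies even when the limit integral is infinite.\<close>

lemma (in prob_space) laplace_functional_PPP:
  assumes X: "homogeneous_PPP M lam X" and lam: "lam > 0"
    and f[measurable]: "f \<in> borel_measurable borel"
  shows "(\<integral>\<^sup>+w. expn (\<Sum>k. f (X k w)) \<partial>M)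
       = expn (ennreal lam * (\<integral>\<^sup>+x. 1 - expn (f x) \<partial>lborel))"
proof -
  have [measurable]: "X k \<in> borel_measurable M" for k
    using X by (auto simp: homogeneous_PPP_def)
  obtain u where u: "\<And>i. simple_function borel (u i)" "incseq u" "\<And>i x. u i x < \<top>"
     "\<And>x. (SUP i. u i x) = f x"
    using borel_measurable_implies_simple_function_sequence'[OF f] by metis
  define g where "g i x = u i x * indicator (ball 0 (real i)) x" for i x
  have [measurable]: "u i \<in> borel_measurable borel" for i
    using u(1) by (rule borel_measurable_simple_function)
  have g_meas[measurable]: "g i \<in> borel_measurable borel" for i
    unfolding g_def by (intro borel_measurable_times_ennreal borel_measurable_indicator) auto
  have incg: "incseq g"
    using u(2) by (auto simp: incseq_def g_def le_fun_def indicator_def)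
  have incgx: "incseq (\<lambda>i. g i x)" for x
    using incg unfolding incseq_def le_fun_def by blast
  have g_lim: "(\<lambda>i. g i x) \<longlonglongrightarrow> f x" for x
  proof -
    have "(\<lambda>i. u i x) \<longlonglongrightarrow> (SUP i. u i x)"
      using u(2) unfolding incseq_def le_fun_def by (intro LIMSEQ_SUP monoI) blast
    then have "(\<lambda>i. u i x) \<longlonglongrightarrow> f x" by (simp add: u)
    moreover have "eventually (\<lambda>i. u i x = g i x) sequentially"
      using eventually_gt_at_top[of "nat \<lceil>norm x\<rceil>"]
    proof eventually_elim
      case (elim i)
      then have "norm x < real i" by linarith
      then show ?case by (simp add: g_def)
    qed
    ultimately show ?thesis by (rule Lim_transform_eventually)
  qed
  have g_SUP: "(SUP i. g i x) = f x" for x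
    using LIMSEQ_unique[OF g_lim LIMSEQ_SUP[OF incgx]] by simp
  have step: "(\<integral>\<^sup>+w. expn (\<Sum>k. g i (X k w)) \<partial>M)
       = expn (ennreal lam * (\<integral>\<^sup>+x. 1 - expn (g i x) \<partial>lborel))" for i
    unfolding g_def by (rule laplace_functional_PPP_simple[OF X lam u(1) u(3)]) auto
  have "(\<lambda>i. \<integral>\<^sup>+w. expn (\<Sum>k. g i (X k w)) \<partial>M) \<longlonglongrightarrow> (\<integral>\<^sup>+w. expn (\<Sum>k. f (X k w)) \<partial>M)"
  proof (rule nn_integral_dominated_convergence[where w="\<lambda>_. 1"])
    have "(\<lambda>i. \<Sum>k. g i (X k w)) \<longlonglongrightarrow> (\<Sum>k. f (X k w))" for w
    proof -
      have "(\<lambda>i. \<Sum>k. g i (X k w)) \<longlonglongrightarrow> (SUP i. \<Sum>k. g i (X k w))"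
        by (intro LIMSEQ_SUP monoI suminf_le allI incseqD[OF incgx]) auto
      also have "(SUP i. \<Sum>k. g i (X k w)) = (\<Sum>k. f (X k w))"
        using incgx by (subst ennreal_suminf_SUP_eq[symmetric]) (auto simp: g_SUP)
      finally show ?thesis .
    qed
    then show "AE w in M. (\<lambda>i. expn (\<Sum>k. g i (X k w))) \<longlonglongrightarrow> expn (\<Sum>k. f (X k w))"
      by (intro AE_I2 tendsto_expn)
  qed (auto simp: expn_le_1 emeasure_space_1)
  \<comment> \<open>The limit integral may be infinite; \<open>lam > 0\<close> rules out the
    indeterminate product of 0 and infinity.\<close>
  moreover have "(\<lambda>i. expn (ennreal lam * (\<integral>\<^sup>+x. 1 - expn (g i x) \<partial>lborel)))
      \<longlonglongrightarrow> expn (ennreal lam * (\<integral>\<^sup>+x. 1 - expn (f x) \<partial>lborel))"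
  proof (intro tendsto_expn tendsto_mult_ennreal tendsto_const)
    have inc: "incseq (\<lambda>i x. 1 - expn (g i x))"
      using incgx unfolding incseq_def le_fun_def by (blast intro: ennreal_minus_mono expn_antimono order_refl)
    have "(\<lambda>i. \<integral>\<^sup>+x. 1 - expn (g i x) \<partial>lborel) \<longlonglongrightarrow> (SUP i. \<integral>\<^sup>+x. 1 - expn (g i x) \<partial>lborel)"
      using inc unfolding incseq_def le_fun_def by (intro LIMSEQ_SUP monoI nn_integral_mono) blast
    also have "(SUP i. \<integral>\<^sup>+x. 1 - expn (g i x) \<partial>lborel) = (\<integral>\<^sup>+x. (SUP i. 1 - expn (g i x)) \<partial>lborel)"
      by (rule nn_integral_monotone_convergence_SUP[symmetric, OF inc]) measurable
    also have "(\<lambda>x. SUP i. 1 - expn (g i x)) = (\<lambda>x. 1 - expn (f x))"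
    proof
      fix x
      have "(\<lambda>i. 1 - expn (g i x)) \<longlonglongrightarrow> (SUP i. 1 - expn (g i x))"
        using inc unfolding incseq_def le_fun_def by (intro LIMSEQ_SUP monoI) blast
      \<comment> \<open>Subtraction on the extended half line is continuous at finite arguments, and
        \<open>expn\<close> never takes the value \<open>\<top>\<close>.\<close>
      moreover have "(\<lambda>i. 1 - expn (g i x)) \<longlonglongrightarrow> 1 - expn (f x)"
        by (intro tendsto_diff_ennreal tendsto_const tendsto_expn g_lim) (auto simp: expn_def)
      ultimately show "(SUP i. 1 - expn (g i x)) = 1 - expn (f x)"
        by (rule LIMSEQ_unique)
    qed
    finally show "(\<lambda>i. \<integral>\<^sup>+x. 1 - expn (g i x) \<partial>lborel) \<longlonglongrightarrow> (\<integral>\<^sup>+x. 1 - expn (f x) \<partial>lborel)" .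
  qed (use lam in auto)
  ultimately show ?thesis
    unfolding step by (rule LIMSEQ_unique)
qed

section \<open>Exponential fading\<close>

text \<open>Independence is the product rule on rectangles, and two measures that agree on
  rectangles coincide when the factors are sigma-finite.\<close>

lemma (in prob_space) indep_rv2_distr:
  assumes "indep_rv2 M Ma A Mb B"
  shows "distr M (Ma \<Otimes>\<^sub>M Mb) (\<lambda>w. (A w, B w)) = distr M Ma A \<Otimes>\<^sub>M distr M Mb B"
proof (rule pair_measure_eqI[symmetric])
  have [measurable]: "A \<in> measurable M Ma" "B \<in> measurable M Mb"
    and ind: "indep_set {A -` E \<inter> space M |E. E \<in> sets Ma} {B -` E \<inter> space M |E. E \<in> sets Mb}"
    using assms by (auto simp: indep_rv2_def)
  interpret PA: prob_space "distr M Ma A" by (rule prob_space_distr) fact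
  interpret PB: prob_space "distr M Mb B" by (rule prob_space_distr) fact
  show "sigma_finite_measure (distr M Ma A)" "sigma_finite_measure (distr M Mb B)" ..
  show "sets (distr M Ma A \<Otimes>\<^sub>M distr M Mb B) = sets (distr M (Ma \<Otimes>\<^sub>M Mb) (\<lambda>w. (A w, B w)))"
    by (simp cong: sets_pair_measure_cong)
  fix E F assume "E \<in> sets (distr M Ma A)" "F \<in> sets (distr M Mb B)"
  then have [measurable]: "E \<in> sets Ma" "F \<in> sets Mb" by auto
  have "prob ((A -` E \<inter> space M) \<inter> (B -` F \<inter> space M)) = prob (A -` E \<inter> space M) * prob (B -` F \<inter> space M)"
    by (rule indep_setD[OF ind]) auto
  moreover have "(A -` E \<inter> space M) \<inter> (B -` F \<inter> space M) = (\<lambda>w. (A w, B w)) -` (E \<times> F) \<inter> space M"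
    by auto
  ultimately show "emeasure (distr M Ma A) E * emeasure (distr M Mb B) F
      = emeasure (distr M (Ma \<Otimes>\<^sub>M Mb) (\<lambda>w. (A w, B w))) (E \<times> F)"
    by (simp add: emeasure_distr emeasure_eq_measure flip: ennreal_mult)
qed

text \<open>Tonelli for the joint law. The second sample point \<open>w'\<close> allows
  \<open>A\<close> to be frozen while \<open>B\<close> is averaged, which replaces conditional
  expectations throughout.\<close>

lemma (in prob_space) nn_integral_indep_rv2:
  assumes ind: "indep_rv2 M Ma A Mb B"
    and f: "f \<in> borel_measurable (Ma \<Otimes>\<^sub>M Mb)"
  shows "(\<integral>\<^sup>+w. f (A w, B w) \<partial>M) = (\<integral>\<^sup>+w. (\<integral>\<^sup>+w'. f (A w, B w') \<partial>M) \<partial>M)"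
proof -
  have [measurable]: "A \<in> measurable M Ma" "B \<in> measurable M Mb"
    using ind by (auto simp: indep_rv2_def)
  note [measurable] = f
  interpret PB: prob_space "distr M Mb B" by (rule prob_space_distr) fact
  have "(\<integral>\<^sup>+w. f (A w, B w) \<partial>M) = (\<integral>\<^sup>+z. f z \<partial>distr M (Ma \<Otimes>\<^sub>M Mb) (\<lambda>w. (A w, B w)))"
    by (simp add: nn_integral_distr)
  also have "\<dots> = (\<integral>\<^sup>+a. (\<integral>\<^sup>+b. f (a, b) \<partial>distr M Mb B) \<partial>distr M Ma A)"
    unfolding indep_rv2_distr[OF ind] by (subst PB.nn_integral_fst[symmetric]) auto
  also have "\<dots> = (\<integral>\<^sup>+w. (\<integral>\<^sup>+b. f (A w, b) \<partial>distr M Mb B) \<partial>M)"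
    by (subst nn_integral_distr) measurable
  also have "\<dots> = (\<integral>\<^sup>+w. (\<integral>\<^sup>+w'. f (A w, B w') \<partial>M) \<partial>M)"
  proof (rule nn_integral_cong)
    fix w assume [simp]: "w \<in> space M"
    have [simp]: "A w \<in> space Ma" by (rule measurable_space[OF \<open>A \<in> measurable M Ma\<close>]) fact
    show "(\<integral>\<^sup>+b. f (A w, b) \<partial>distr M Mb B) = (\<integral>\<^sup>+w'. f (A w, B w') \<partial>M)"
      by (subst nn_integral_distr) auto
  qed
  finally show ?thesis .
qed

text \<open>Tilting the unit exponential density by exp(-a y) gives 1 / (1 + a) times the
  exponential density of rate 1 + a, whose total mass is 1.\<close>

lemma (in prob_space) nn_integral_expn_exponential:
  assumes Y: "distributed M lborel Y (exponential_density 1)" and a: "a \<ge> 0"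
  shows "(\<integral>\<^sup>+w. expn (ennreal (a * Y w)) \<partial>M) = ennreal (1 / (1 + a))"
proof -
  interpret E: prob_space "density lborel (exponential_density (1 + a))"
    using a by (intro prob_space_exponential_density) auto
  have "(\<integral>\<^sup>+w. expn (ennreal (a * Y w)) \<partial>M)
      = (\<integral>\<^sup>+y. ennreal (exponential_density 1 y) * expn (ennreal (a * y)) \<partial>lborel)"
    by (rule distributed_nn_integral[OF Y, symmetric]) measurable
  also have "\<dots> = (\<integral>\<^sup>+y. ennreal (1 / (1 + a)) * (ennreal (exponential_density (1 + a) y) * indicator UNIV y) \<partial>lborel)"
  proof (rule nn_integral_cong)
    fix y :: real
    \<comment> \<open>For negative \<open>y\<close> the truncation of \<open>a * y\<close> to 0 has
      no effect, because both densities vanish there.\<close>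
    show "ennreal (exponential_density 1 y) * expn (ennreal (a * y))
        = ennreal (1 / (1 + a)) * (ennreal (exponential_density (1 + a) y) * indicator UNIV y)"
      using a by (auto simp: exponential_density_def erlang_density_def field_simps
           simp flip: ennreal_mult exp_add)
  qed
  also have "\<dots> = ennreal (1 / (1 + a)) * emeasure (density lborel (exponential_density (1 + a))) UNIV"
    by (subst nn_integral_cmult) (auto simp: emeasure_density)
  also have "\<dots> = ennreal (1 / (1 + a))"
    using E.emeasure_space_1 by simp
  finally show ?thesis .
qed

lemma (in prob_space) AE_exponential_nonneg:
  assumes Y: "distributed M lborel Y (exponential_density 1)"
  shows "AE w in M. Y w \<ge> 0"
proof -
  have "AE x in density lborel (exponential_density 1). x \<ge> (0::real)"
    by (subst AE_density) (auto simp: exponential_density_def erlang_density_def)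
  then have "AE x in distr M lborel Y. x \<ge> 0"
    by (simp only: distributed_distr_eq_density[OF Y])
  then show ?thesis
    using distributed_measurable[OF Y] by (subst (asm) AE_distr_iff) auto
qed

text \<open>Since b \<le> v, the event differs from v < H at most at the single value v, which is
  null. The mixed strict and weak inequalities arise because both the outage and the conditioning
  event are strict, and the first of them gets negated.\<close>

lemma (in prob_space) exponential_tail:
  assumes H: "distributed M lborel H (exponential_density 1)" and b: "0 \<le> b" "b \<le> v"
  shows "(\<integral>\<^sup>+w. indicator {h. b < h \<and> v \<le> h} (H w) \<partial>M) = ennreal (exp (- v))"
proof -
  note Hm [measurable] = distributed_measurable[OF H, simplified]
  have "AE x in distr M lborel H. x \<noteq> v"
    unfolding distributed_distr_eq_density[OF H]
    by (subst AE_density) (use AE_lborel_singleton[of v] in auto)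
  then have "AE w in M. H w \<noteq> v"
    by (subst (asm) AE_distr_iff) auto
  then have "(\<integral>\<^sup>+w. indicator {h. b < h \<and> v \<le> h} (H w) \<partial>M) = (\<integral>\<^sup>+w. indicator {w \<in> space M. v < H w} w \<partial>M)"
    by (intro nn_integral_cong_AE, elim AE_mp) (use b in \<open>auto intro!: AE_I2 simp: indicator_def\<close>)
  also have "\<dots> = emeasure M {w \<in> space M. v < H w}"
    by (rule nn_integral_indicator) measurable
  also have "\<dots> = ennreal (exp (- v))"
    using exponential_distributedD_gt[OF H, of v] b by (simp add: emeasure_eq_measure)
  finally show ?thesis .
qed

text \<open>With the points frozen, each independent mark contributes the factor 1 / (1 + a) =
  exp(-ln (1 + a)), so the marks can be traded for a deterministic function of the points. The
  product rule needs finitely many factors; partial sums are treated and the limit is taken under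
  the dominating constant 1.\<close>

lemma (in prob_space) laplace_functional_exponential_marks:
  assumes X: "\<And>k. X k \<in> borel_measurable M"
    and S: "\<And>k::nat. distributed M lborel (S k) (exponential_density 1)"
    and indS: "indep_vars (\<lambda>_. borel) S UNIV"
    and ind: "indep_rv2 M (Pi\<^sub>M UNIV (\<lambda>_. borel)) (\<lambda>w k. X k w) (Pi\<^sub>M UNIV (\<lambda>_. borel)) (\<lambda>w k. S k w)"
    and a[measurable]: "a \<in> borel_measurable borel" and a0: "\<And>x. a x \<ge> (0::real)"
  shows "(\<integral>\<^sup>+w. expn (\<Sum>k. ennreal (a (X k w) * S k w)) \<partial>M)
       = (\<integral>\<^sup>+w. expn (\<Sum>k. ennreal (ln (1 + a (X k w)))) \<partial>M)"
proof -
  note [measurable] = X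
  have [measurable]: "S k \<in> borel_measurable M" for k
    using distributed_measurable[OF S] by simp
  have step: "(\<integral>\<^sup>+w. expn (\<Sum>k<K. ennreal (a (X k w) * S k w)) \<partial>M)
       = (\<integral>\<^sup>+w. expn (\<Sum>k<K. ennreal (ln (1 + a (X k w)))) \<partial>M)" for K
  proof -
    define f where "f = (\<lambda>(x, s). expn (\<Sum>k<K. ennreal (a (x k) * s k)))"
    have [measurable]: "f \<in> borel_measurable (Pi\<^sub>M UNIV (\<lambda>_. borel) \<Otimes>\<^sub>M Pi\<^sub>M UNIV (\<lambda>_. borel))"
      unfolding f_def by measurable
    have "(\<integral>\<^sup>+w. expn (\<Sum>k<K. ennreal (a (X k w) * S k w)) \<partial>M)
        = (\<integral>\<^sup>+w. (\<integral>\<^sup>+w'. expn (\<Sum>k<K. ennreal (a (X k w) * S k w')) \<partial>M) \<partial>M)"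
      using nn_integral_indep_rv2[OF ind, of f] by (simp add: f_def)
    also have "\<dots> = (\<integral>\<^sup>+w. expn (\<Sum>k<K. ennreal (ln (1 + a (X k w)))) \<partial>M)"
    proof (rule nn_integral_cong)
      fix w
      have "(\<integral>\<^sup>+w'. expn (\<Sum>k<K. ennreal (a (X k w) * S k w')) \<partial>M)
          = (\<Prod>k<K. \<integral>\<^sup>+w'. expn (ennreal (a (X k w) * S k w')) \<partial>M)"
        unfolding expn_sum
        by (intro indep_vars_nn_integral indep_vars_compose2[OF indep_vars_subset[OF indS]]) auto
      also have "\<dots> = (\<Prod>k<K. expn (ennreal (ln (1 + a (X k w)))))"
      proof (intro prod.cong refl)
        fix k
        have "exp (- ln (1 + a (X k w))) = 1 / (1 + a (X k w))"
          using a0[of "X k w"] by (simp add: exp_minus field_simps)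
        then show "(\<integral>\<^sup>+w'. expn (ennreal (a (X k w) * S k w')) \<partial>M) = expn (ennreal (ln (1 + a (X k w))))"
          using a0[of "X k w"] nn_integral_expn_exponential[OF S a0] by simp
      qed
      finally show "(\<integral>\<^sup>+w'. expn (\<Sum>k<K. ennreal (a (X k w) * S k w')) \<partial>M)
          = expn (\<Sum>k<K. ennreal (ln (1 + a (X k w))))"
        by (simp add: expn_sum)
    qed
    finally show ?thesis .
  qed
  have lim: "(\<lambda>K. \<integral>\<^sup>+w. expn (\<Sum>k<K. f k w) \<partial>M) \<longlonglongrightarrow> (\<integral>\<^sup>+w. expn (\<Sum>k. f k w) \<partial>M)"
    if [measurable]: "\<And>k. f k \<in> borel_measurable M" for f :: "nat \<Rightarrow> 'a \<Rightarrow> ennreal"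
    by (rule nn_integral_dominated_convergence[where w="\<lambda>_. 1"])
       (auto simp: expn_le_1 emeasure_space_1 intro!: tendsto_expn summable_LIMSEQ)
  have "(\<lambda>K. \<integral>\<^sup>+w. expn (\<Sum>k<K. ennreal (a (X k w) * S k w)) \<partial>M)
      \<longlonglongrightarrow> (\<integral>\<^sup>+w. expn (\<Sum>k. ennreal (a (X k w) * S k w)) \<partial>M)"
    by (rule lim) measurable
  moreover have "(\<lambda>K. \<integral>\<^sup>+w. expn (\<Sum>k<K. ennreal (ln (1 + a (X k w)))) \<partial>M)
      \<longlonglongrightarrow> (\<integral>\<^sup>+w. expn (\<Sum>k. ennreal (ln (1 + a (X k w)))) \<partial>M)"
    by (rule lim) measurable
  ultimately show ?thesis
    unfolding step by (rule LIMSEQ_unique)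
qed

section \<open>The path loss integral\<close>

text \<open>\<open>h x\<close> is the length of the interval from 0 to \<open>h x\<close>;
  exchanging the two integrations gives the claim.\<close>

lemma nn_integral_layer_cake:
  fixes h :: "'b::euclidean_space \<Rightarrow> real"
  assumes [measurable]: "h \<in> borel_measurable borel" and h: "\<And>x. 0 \<le> h x"
  shows "(\<integral>\<^sup>+x. ennreal (h x) \<partial>lborel) = (\<integral>\<^sup>+t. emeasure lborel {x. 0 < t \<and> t < h x} \<partial>lborel)"
proof -
  have "(\<integral>\<^sup>+x. ennreal (h x) \<partial>lborel) = (\<integral>\<^sup>+x. (\<integral>\<^sup>+t. indicator {t. 0 < t \<and> t < h x} t \<partial>lborel) \<partial>lborel)"
  proof (rule nn_integral_cong)
    fix x
    have "{t. 0 < t \<and> t < h x} = {0<..<h x}" by auto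
    then show "ennreal (h x) = (\<integral>\<^sup>+t. indicator {t. 0 < t \<and> t < h x} t \<partial>lborel)"
      using h[of x] by simp
  qed
  \<comment> \<open>The conditional form exhibits the integrand as a jointly measurable function of
    \<open>x\<close> and \<open>t\<close>, as the exchange requires.\<close>
  also have "\<dots> = (\<integral>\<^sup>+x. (\<integral>\<^sup>+t. (if 0 < t \<and> t < h x then 1 else 0) \<partial>lborel) \<partial>lborel)"
    by (intro nn_integral_cong) (auto simp: indicator_def)
  also have "\<dots> = (\<integral>\<^sup>+t. (\<integral>\<^sup>+x. (if 0 < t \<and> t < h x then 1 else 0) \<partial>lborel) \<partial>lborel)"
    by (rule lborel_pair.Fubini') measurable
  also have "\<dots> = (\<integral>\<^sup>+t. (\<integral>\<^sup>+x. indicator {x. 0 < t \<and> t < h x} x \<partial>lborel) \<partial>lborel)"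
    by (intro nn_integral_cong) (auto simp: indicator_def)
  also have "\<dots> = (\<integral>\<^sup>+t. emeasure lborel {x. 0 < t \<and> t < h x} \<partial>lborel)"
    by (intro nn_integral_cong nn_integral_indicator) measurable
  finally show ?thesis .
qed

text \<open>At distance r > 0 from T the function equals q / (q + r^alpha), which decreases in r, so
  the level set is a disc around T. Its radius \<open>rho\<close> solves q / (q + rho^alpha) =
  t.\<close>

lemma path_loss_level_set:
  fixes T :: point
  assumes alpha: "alpha > 2" and q: "q > 0" and t: "0 < t" "t < 1"
  shows "emeasure lborel {x. t < (q / dist x T powr alpha) / (1 + q / dist x T powr alpha)}
     = ennreal (pi * q powr (2 / alpha) * (t powr (- 2 / alpha) * (1 - t) powr (2 / alpha)))"
proof -
  define rho where "rho = (q * (1 - t) / t) powr (1 / alpha)"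
  have rho: "rho > 0" "rho powr alpha = q * (1 - t) / t"
    using alpha q t by (auto simp: rho_def powr_powr)
  define h where "h x = (q / dist x T powr alpha) / (1 + q / dist x T powr alpha)" for x
  have level: "t < h x \<longleftrightarrow> dist x T < rho" if "x \<noteq> T" for x
  proof -
    define r where "r = dist x T"
    have r: "r > 0" using that by (simp add: r_def)
    have "t < (q / r powr alpha) / (1 + q / r powr alpha) \<longleftrightarrow> t < q / (r powr alpha + q)"
      using r q by (simp add: field_simps)
    also have "\<dots> \<longleftrightarrow> r powr alpha < q * (1 - t) / t"
      using r q t by (simp add: field_simps pos_less_divide_eq add_pos_pos)
    also have "\<dots> \<longleftrightarrow> r < rho"
      unfolding rho(2)[symmetric]
      using r rho(1) alpha powr_less_mono2[of alpha r rho] powr_mono2[of alpha rho r]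
      by (cases "r < rho") auto
    finally show ?thesis by (simp add: r_def h_def)
  qed
  \<comment> \<open>At the centre, division by 0 gives the default value 0, so T itself drops out of
    the level set; a single point has no area.\<close>
  have "h T = 0" by (simp add: h_def)
  then have "t < h x \<longleftrightarrow> x \<in> ball T rho - {T}" for x
    using t level[of x] by (cases "x = T") (simp_all add: dist_commute)
  then have "{x. t < h x} = ball T rho - {T}"
    by blast
  then have "emeasure lborel {x. t < h x} = emeasure lborel (ball T rho)"
    by (simp add: emeasure_Diff_null_set countable_imp_null_set_lborel)
  also have "\<dots> = ennreal (pi * rho\<^sup>2)"
    using rho(1) by (simp add: emeasure_ball unit_ball_vol_2 power2_eq_square)
  also have "rho\<^sup>2 = q powr (2 / alpha) * (t powr (- 2 / alpha) * (1 - t) powr (2 / alpha))"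
  proof -
    have "rho\<^sup>2 = (q * (1 - t) / t) powr (2 / alpha)"
      using q t by (simp add: rho_def powr_power)
    also have "\<dots> = q powr (2 / alpha) * (1 - t) powr (2 / alpha) / t powr (2 / alpha)"
      using q t by (simp add: powr_divide powr_mult)
    finally show ?thesis
      using t by (simp add: powr_minus divide_inverse mult_ac)
  qed
  finally show ?thesis by (simp add: h_def mult.assoc)
qed

lemma nn_integral_path_loss:
  fixes T :: point
  assumes alpha: "alpha > 2" and q: "q > 0"
  shows "(\<integral>\<^sup>+x. 1 - expn (ennreal (ln (1 + q / dist x T powr alpha))) \<partial>lborel)
     = ennreal (pi * q powr (2 / alpha) * (Gamma (1 + 2 / alpha) * Gamma (1 - 2 / alpha)))"
proof -
  define a where "a x = q / dist x T powr alpha" for x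
  have a0: "a x \<ge> 0" for x using q by (simp add: a_def)
  have [measurable]: "a \<in> borel_measurable borel" unfolding a_def by measurable
  have "(\<integral>\<^sup>+x. 1 - expn (ennreal (ln (1 + a x))) \<partial>lborel) = (\<integral>\<^sup>+x. ennreal (a x / (1 + a x)) \<partial>lborel)"
  proof (rule nn_integral_cong)
    fix x
    have "1 - exp (- ln (1 + a x)) = a x / (1 + a x)"
      using a0[of x] by (simp add: exp_minus field_simps)
    then show "1 - expn (ennreal (ln (1 + a x))) = ennreal (a x / (1 + a x))"
      using a0[of x] by (simp add: ennreal_minus flip: ennreal_1)
  qed
  also have "\<dots> = (\<integral>\<^sup>+t. emeasure lborel {x. 0 < t \<and> t < a x / (1 + a x)} \<partial>lborel)"
    using a0 by (intro nn_integral_layer_cake) auto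
  also have "\<dots> = (\<integral>\<^sup>+t. ennreal (pi * q powr (2 / alpha)) *
      (ennreal (t powr (- 2 / alpha) * (1 - t) powr (2 / alpha)) * indicator {0..1} t) \<partial>lborel)"
  \<comment> \<open>The endpoints 0 and 1 are null. For t < 0 the guard 0 < t empties the level set;
    for t > 1 it is empty because a / (1 + a) < 1.\<close>
  proof (rule nn_integral_cong_AE, use AE_lborel_singleton[of 0] AE_lborel_singleton[of 1] in eventually_elim)
    case (elim t)
    consider "t < 0" | "0 < t" "t < 1" | "t > 1" using elim by linarith
    then show ?case
    proof cases
      case 2
      then show ?thesis
        using path_loss_level_set[OF alpha q 2, of T] q by (simp add: a_def flip: ennreal_mult)
    next
      case 3
      have "a x / (1 + a x) < 1" for x using a0[of x] by simp
      then have *: "\<not> t < a x / (1 + a x)" for x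
        using 3 by (meson less_asym order.strict_trans)
      show ?thesis
        using 3 by (simp add: *)
    qed auto
  qed
  \<comment> \<open>The Beta exponents are (1 - 2/alpha) - 1 = -2/alpha at t = 0 and (1 + 2/alpha) -
    1 = 2/alpha at t = 1.\<close>
  also have "\<dots> = ennreal (pi * q powr (2 / alpha)) * ennreal (Beta (1 - 2 / alpha) (1 + 2 / alpha))"
  proof (subst nn_integral_cmult)
    show "ennreal (pi * q powr (2 / alpha)) *
        (\<integral>\<^sup>+t. ennreal (t powr (- 2 / alpha) * (1 - t) powr (2 / alpha)) * indicator {0..1} t \<partial>lborel)
      = ennreal (pi * q powr (2 / alpha)) * ennreal (Beta (1 - 2 / alpha) (1 + 2 / alpha))"
      using has_integral_Beta_real[of "1 - 2 / alpha" "1 + 2 / alpha"] alpha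
      by (subst nn_integral_has_integral_lebesgue') (auto simp: field_simps)
  qed measurable
  \<comment> \<open>The two arguments add up to 2, and \<open>Gamma\<close> 2 = 1 removes the
    denominator.\<close>
  also have "Beta (1 - 2 / alpha) (1 + 2 / alpha) = Gamma (1 + 2 / alpha) * Gamma (1 - 2 / alpha)"
    by (simp add: Beta_def Gamma_numeral)
  finally show ?thesis
    using q by (simp only: a_def ennreal_mult' [symmetric] mult_nonneg_nonneg pi_ge_zero powr_ge_zero)
qed

section \<open>Secrecy outage\<close>

text \<open>The independence assumption on \<open>H\<close> names it first, whereas the secrecy
  computation freezes points and marks and integrates \<open>H\<close> innermost.\<close>

lemma (in prob_space) indep_rv2_commute:
  assumes "indep_rv2 M Ma A Mb B"
  shows "indep_rv2 M Mb B Ma A"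
proof -
  have swap: "indep_set V U" if UV: "indep_set U V" for U V
    unfolding indep_sets2_eq
  proof (intro conjI ballI)
    show "V \<subseteq> events" "U \<subseteq> events"
      using UV by (rule indep_setD_ev2, rule indep_setD_ev1)
    show "prob (a \<inter> b) = prob a * prob b" if "a \<in> V" "b \<in> U" for a b
      using indep_setD[OF UV that(2,1)] by (simp only: Int_commute[of b a] mult.commute)
  qed
  show ?thesis
    using assms swap unfolding indep_rv2_def by blast
qed

text \<open>As a function of \<open>q\<close> this is the Laplace transform of a positive stable law
  of index 2/alpha. It is stated for the extended sum, so no convergence is presupposed and it can
  serve to prove convergence.\<close>

lemma (in prob_space) laplace_shot_noise:
  fixes T :: point
  assumes X: "homogeneous_PPP M lam X" and lam: "lam > 0"
    and S: "\<And>k::nat. distributed M lborel (S k) (exponential_density 1)"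
    and indS: "indep_vars (\<lambda>_. borel) S UNIV"
    and ind: "indep_rv2 M (Pi\<^sub>M UNIV (\<lambda>_. borel)) (\<lambda>w k. X k w) (Pi\<^sub>M UNIV (\<lambda>_. borel)) (\<lambda>w k. S k w)"
    and alpha: "alpha > 2" and q: "q > 0"
  shows "(\<integral>\<^sup>+w. expn (ennreal q * (\<Sum>k. ennreal (S k w / dist (X k w) T powr alpha))) \<partial>M)
       = ennreal (exp (- (pi * lam * Gamma (1 + 2 / alpha) * Gamma (1 - 2 / alpha) * q powr (2 / alpha))))"
proof -
  have Gpos: "Gamma (1 + 2 / alpha) > 0" "Gamma (1 - 2 / alpha) > 0"
    using alpha by (auto intro!: Gamma_real_pos add_pos_pos)
  have "(\<integral>\<^sup>+w. expn (ennreal q * (\<Sum>k. ennreal (S k w / dist (X k w) T powr alpha))) \<partial>M)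
      = (\<integral>\<^sup>+w. expn (\<Sum>k. ennreal (q / dist (X k w) T powr alpha * S k w)) \<partial>M)"
    using q by (simp add: mult_ac flip: ennreal_suminf_cmult ennreal_mult')
  also have "\<dots> = (\<integral>\<^sup>+w. expn (\<Sum>k. ennreal (ln (1 + q / dist (X k w) T powr alpha))) \<partial>M)"
    using X q by (intro laplace_functional_exponential_marks[OF _ S indS ind]) (auto simp: homogeneous_PPP_def)
  also have "\<dots> = expn (ennreal lam * (\<integral>\<^sup>+x. 1 - expn (ennreal (ln (1 + q / dist x T powr alpha))) \<partial>lborel))"
    by (rule laplace_functional_PPP[OF X lam]) measurable
  also have "\<dots> = ennreal (exp (- (pi * lam * Gamma (1 + 2 / alpha) * Gamma (1 - 2 / alpha) * q powr (2 / alpha))))"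
    unfolding nn_integral_path_loss[OF alpha q] using lam Gpos q
    by (simp add: less_imp_le mult_ac flip: ennreal_mult)
  finally show ?thesis .
qed

text \<open>The Laplace transform is at most the probability that the shot noise is finite, and it tends
  to 1 as q tends to 0. Without this the real-valued infinite sum in the theorem would be a
  junk value.\<close>
lemma (in prob_space) AE_shot_noise_summable:
  fixes T :: point
  assumes X: "homogeneous_PPP M lam X" and lam: "lam > 0"
    and S: "\<And>k::nat. distributed M lborel (S k) (exponential_density 1)"
    and indS: "indep_vars (\<lambda>_. borel) S UNIV"
    and ind: "indep_rv2 M (Pi\<^sub>M UNIV (\<lambda>_. borel)) (\<lambda>w k. X k w) (Pi\<^sub>M UNIV (\<lambda>_. borel)) (\<lambda>w k. S k w)"
    and alpha: "alpha > 2"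
  shows "AE w in M. (\<forall>k. 0 \<le> S k w) \<and> summable (\<lambda>k. S k w / dist (X k w) T powr alpha)"
proof -
  have [measurable]: "X k \<in> borel_measurable M" "S k \<in> borel_measurable M" for k
    using X distributed_measurable[OF S] by (auto simp: homogeneous_PPP_def)
  define Y where "Y w = (\<Sum>k. ennreal (S k w / dist (X k w) T powr alpha))" for w
  have [measurable]: "Y \<in> borel_measurable M" unfolding Y_def by measurable
  define K where "K = pi * lam * Gamma (1 + 2 / alpha) * Gamma (1 - 2 / alpha)"
  have K: "K > 0" using lam alpha by (auto simp: K_def intro!: mult_pos_pos Gamma_real_pos add_pos_pos)
  let ?F = "{w \<in> space M. Y w < \<top>}"
  have lower: "exp (- e) \<le> prob ?F" if e: "e > 0" for e :: real
  proof -
    \<comment> \<open>Chosen so that the exponent K * q^(2/alpha) of the transform is exactly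
      \<open>e\<close>.\<close>
    define q where "q = (e / K) powr (alpha / 2)"
    have q: "q > 0" "K * q powr (2 / alpha) = e"
      using e K alpha by (auto simp: q_def powr_powr)
    have "ennreal (exp (- e)) = (\<integral>\<^sup>+w. expn (ennreal q * Y w) \<partial>M)"
      using laplace_shot_noise[OF X lam S indS ind alpha q(1), of T] q(2) by (simp add: K_def Y_def)
    also have "\<dots> \<le> (\<integral>\<^sup>+w. indicator ?F w \<partial>M)"
      using q(1) expn_le_1
      by (intro nn_integral_mono) (auto simp: indicator_def not_less top_unique ennreal_mult_top)
    also have "\<dots> = ennreal (prob ?F)"
      by (simp add: emeasure_eq_measure)
    finally show ?thesis by simp
  qed
  have "1 \<le> prob ?F"
  proof (rule field_le_epsilon)
    fix e :: real assume "e > 0"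
    have "1 - e \<le> exp (- e)" using exp_ge_add_one_self[of "- e"] by simp
    then show "1 \<le> prob ?F + e" using lower[OF \<open>e > 0\<close>] by simp
  qed
  then have "prob ?F = 1" using prob_le_1[of ?F] by linarith
  then have "AE w in M. Y w < \<top>" using prob_Collect_eq_1[of "\<lambda>w. Y w < \<top>"] by simp
  moreover have "AE w in M. \<forall>k. 0 \<le> S k w"
    using AE_exponential_nonneg[OF S] by (simp add: AE_all_countable)
  ultimately show ?thesis
  proof eventually_elim
    case (elim w)
    then show ?case by (auto simp: Y_def intro!: summable_suminf_not_top)
  qed
qed

text \<open>The memoryless tail at \<open>b + q * Z\<close> splits into exp(-b), which conditioning
  later cancels, and exp(-q Z), whose mean is the Laplace transform of the shot noise.\<close>

lemma (in prob_space) secrecy_success_joint: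
  fixes T :: point
  assumes X: "homogeneous_PPP M lam X" and lam: "lam > 0"
    and H: "distributed M lborel H (exponential_density 1)"
    and S: "\<And>k::nat. distributed M lborel (S k) (exponential_density 1)"
    and indS: "indep_vars (\<lambda>_. borel) S UNIV"
    and ind: "indep_rv2 M (Pi\<^sub>M UNIV (\<lambda>_. borel)) (\<lambda>w k. X k w) (Pi\<^sub>M UNIV (\<lambda>_. borel)) (\<lambda>w k. S k w)"
    and indH: "indep_rv2 M borel H (Pi\<^sub>M UNIV (\<lambda>_. borel) \<Otimes>\<^sub>M Pi\<^sub>M UNIV (\<lambda>_. borel))
        (\<lambda>w. ((\<lambda>k. X k w), (\<lambda>k. S k w)))"
    and alpha: "alpha > 2" and b: "b \<ge> 0" and q: "q > 0"
  shows "prob {w \<in> space M. b < H w \<and> b + q * (\<Sum>k. S k w / dist (X k w) T powr alpha) \<le> H w}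
     = exp (- b) * exp (- (pi * lam * Gamma (1 + 2 / alpha) * Gamma (1 - 2 / alpha) * q powr (2 / alpha)))"
proof -
  have [measurable]: "X k \<in> borel_measurable M" "S k \<in> borel_measurable M" "H \<in> borel_measurable M" for k
    using X distributed_measurable[OF S] distributed_measurable[OF H] by (auto simp: homogeneous_PPP_def)
  define V where "V x s = b + q * (\<Sum>k. s k / dist (x k) T powr alpha)"
    for x :: "nat \<Rightarrow> point" and s :: "nat \<Rightarrow> real"
  define f :: "((nat \<Rightarrow> point) \<times> (nat \<Rightarrow> real)) \<times> real \<Rightarrow> ennreal"
    where "f z = (if b < snd z \<and> V (fst (fst z)) (snd (fst z)) \<le> snd z then 1 else 0)" for z
  have f: "f \<in> borel_measurable ((Pi\<^sub>M UNIV (\<lambda>_. borel) \<Otimes>\<^sub>M Pi\<^sub>M UNIV (\<lambda>_. borel)) \<Otimes>\<^sub>M borel)"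
  proof -
    let ?N = "(Pi\<^sub>M UNIV (\<lambda>_. borel) \<Otimes>\<^sub>M Pi\<^sub>M UNIV (\<lambda>_. borel)) \<Otimes>\<^sub>M borel
      :: (((nat \<Rightarrow> point) \<times> (nat \<Rightarrow> real)) \<times> real) measure"
    have [measurable]: "(\<lambda>z. fst (fst z) k) \<in> borel_measurable ?N" for k
      by (rule measurable_compose[OF measurable_compose[OF measurable_fst measurable_fst]
            measurable_component_singleton]) simp
    have [measurable]: "(\<lambda>z. snd (fst z) k) \<in> borel_measurable ?N" for k
      by (rule measurable_compose[OF measurable_compose[OF measurable_fst measurable_snd]
            measurable_component_singleton]) simp
    have "(\<lambda>z. snd (fst z) k / dist (fst (fst z) k) T powr alpha) \<in> borel_measurable ?N" for k
      by (intro borel_measurable_divide powr_real_measurable borel_measurable_dist) measurable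
    then have [measurable]: "(\<lambda>z. V (fst (fst z)) (snd (fst z))) \<in> borel_measurable ?N"
      unfolding V_def by (intro borel_measurable_add borel_measurable_times borel_measurable_suminf) auto
    have [measurable]: "snd \<in> borel_measurable ?N" by (rule measurable_snd)
    show ?thesis
      unfolding f_def by (intro measurable_If pred_intros_logic borel_measurable_const) measurable
  qed
  have E[measurable]: "{w \<in> space M. b < H w \<and> V (\<lambda>k. X k w) (\<lambda>k. S k w) \<le> H w} \<in> events"
    unfolding V_def by measurable
  have "ennreal (prob {w \<in> space M. b < H w \<and> V (\<lambda>k. X k w) (\<lambda>k. S k w) \<le> H w})
      = (\<integral>\<^sup>+w. indicator {w \<in> space M. b < H w \<and> V (\<lambda>k. X k w) (\<lambda>k. S k w) \<le> H w} w \<partial>M)"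
    by (simp add: emeasure_eq_measure)
  also have "\<dots> = (\<integral>\<^sup>+w. f (((\<lambda>k. X k w), (\<lambda>k. S k w)), H w) \<partial>M)"
    by (intro nn_integral_cong) (simp add: f_def)
  also have "\<dots> = (\<integral>\<^sup>+w. (\<integral>\<^sup>+w'. f (((\<lambda>k. X k w), (\<lambda>k. S k w)), H w') \<partial>M) \<partial>M)"
    by (rule nn_integral_indep_rv2[OF indep_rv2_commute[OF indH] f])
  also have "\<dots> = (\<integral>\<^sup>+w. ennreal (exp (- b)) *
      expn (ennreal q * (\<Sum>k. ennreal (S k w / dist (X k w) T powr alpha))) \<partial>M)"
  proof (rule nn_integral_cong_AE, use AE_shot_noise_summable[OF X lam S indS ind alpha, of T] in eventually_elim)
    case (elim w)
    let ?Z = "\<Sum>k. S k w / dist (X k w) T powr alpha"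
    have Z: "?Z \<ge> 0" using elim by (intro suminf_nonneg) auto
    have "(\<integral>\<^sup>+w'. f (((\<lambda>k. X k w), (\<lambda>k. S k w)), H w') \<partial>M)
        = (\<integral>\<^sup>+w'. indicator {h. b < h \<and> b + q * ?Z \<le> h} (H w') \<partial>M)"
      by (intro nn_integral_cong) (simp add: f_def V_def indicator_def)
    also have "\<dots> = ennreal (exp (- (b + q * ?Z)))"
      using b q Z by (intro exponential_tail[OF H]) auto
    also have "\<dots> = ennreal (exp (- b)) * expn (ennreal q * ennreal ?Z)"
      using q Z by (simp add: exp_add[symmetric] flip: ennreal_mult)
    \<comment> \<open>Summability and nonnegativity, both almost sure, identify the real sum of the
      statement with the extended sum of the transform.\<close>
    also have "ennreal ?Z = (\<Sum>k. ennreal (S k w / dist (X k w) T powr alpha))"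
      using elim by (intro suminf_ennreal2[symmetric]) auto
    finally show ?case .
  qed
  also have "\<dots> = ennreal (exp (- b)) *
      (\<integral>\<^sup>+w. expn (ennreal q * (\<Sum>k. ennreal (S k w / dist (X k w) T powr alpha))) \<partial>M)"
    by (rule nn_integral_cmult) measurable
  also note laplace_shot_noise[OF X lam S indS ind alpha q, of T]
  finally show ?thesis
    by (simp add: V_def flip: ennreal_mult)
qed

text \<open>The complement of the conditional outage probability is P(no outage and Q) / P(Q). Both
  probabilities contain exp(-b), so the quotient is the Laplace transform of the shot noise at
  \<open>q\<close>.\<close>

lemma (in prob_space) hop_secrecy_success:
  fixes T :: point
  assumes X: "homogeneous_PPP M lam X" and lam: "lam > 0"
    and H: "distributed M lborel H (exponential_density 1)"
    and S: "\<And>k::nat. distributed M lborel (S k) (exponential_density 1)"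
    and indS: "indep_vars (\<lambda>_. borel) S UNIV"
    and ind: "indep_rv2 M (Pi\<^sub>M UNIV (\<lambda>_. borel)) (\<lambda>w k. X k w) (Pi\<^sub>M UNIV (\<lambda>_. borel)) (\<lambda>w k. S k w)"
    and indH: "indep_rv2 M borel H (Pi\<^sub>M UNIV (\<lambda>_. borel) \<Otimes>\<^sub>M Pi\<^sub>M UNIV (\<lambda>_. borel))
        (\<lambda>w. ((\<lambda>k. X k w), (\<lambda>k. S k w)))"
    and alpha: "alpha > 2" and Rs: "Rs > 0" and p: "p > 0" and d: "d > 0"
  shows "1 - cond_prob M
      (\<lambda>w. log 2 ((1 + p * H w / d powr alpha) / (1 + (\<Sum>k. p * S k w / dist (X k w) T powr alpha))) < Rs)
      (\<lambda>w. p * H w / d powr alpha > 2 powr Rs - 1)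
    = exp (- (pi * lam * Gamma (1 + 2 / alpha) * Gamma (1 - 2 / alpha) * 2 powr (2 * Rs / alpha) * d\<^sup>2))"
proof -
  have [measurable]: "X k \<in> borel_measurable M" "S k \<in> borel_measurable M" "H \<in> borel_measurable M" for k
    using X distributed_measurable[OF S] distributed_measurable[OF H] by (auto simp: homogeneous_PPP_def)
  \<comment> \<open>\<open>c\<close> is the SNR per unit of fading gain, \<open>b\<close> is the
    gain at which the SNR equals beta_t, and \<open>q\<close> satisfies c * q = p * 2^Rs.\<close>
  define c where "c = p / d powr alpha"
  define b where "b = (2 powr Rs - 1) / c"
  define q where "q = 2 powr Rs * d powr alpha"
  define P where "P w \<longleftrightarrow> log 2 ((1 + p * H w / d powr alpha) / (1 + (\<Sum>k. p * S k w / dist (X k w) T powr alpha))) < Rs" for w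
  define Q where "Q w \<longleftrightarrow> p * H w / d powr alpha > 2 powr Rs - 1" for w
  have [measurable]: "Measurable.pred M P" "Measurable.pred M Q"
    unfolding P_def Q_def by measurable
  have c: "c > 0" using p d by (simp add: c_def)
  have beta: "2 powr Rs > (1::real)" using Rs by simp
  have b: "b \<ge> 0" using c beta by (simp add: b_def)
  have q: "q > 0" using d by (simp add: q_def)
  have Q_iff: "Q w \<longleftrightarrow> b < H w" for w
    using pos_divide_less_eq[OF c, of "2 powr Rs - 1" "H w"] by (simp add: Q_def b_def c_def mult.commute)
  have PQ_iff: "AE w in M. (\<not> P w \<and> Q w) \<longleftrightarrow> b < H w \<and> b + q * (\<Sum>k. S k w / dist (X k w) T powr alpha) \<le> H w"
    using AE_shot_noise_summable[OF X lam S indS ind alpha, of T]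
  proof eventually_elim
    case (elim w)
    let ?Z = "\<Sum>k. S k w / dist (X k w) T powr alpha"
    have Z: "?Z \<ge> 0" using elim by (intro suminf_nonneg) auto
    have sum: "(\<Sum>k. p * S k w / dist (X k w) T powr alpha) = p * ?Z"
      using elim by (subst suminf_mult[symmetric]) auto
    have "P w \<longleftrightarrow> H w < b + q * ?Z" if "Q w"
    proof -
      \<comment> \<open>The restriction to \<open>Q\<close> makes the argument of the logarithm
        positive, so the logarithm can be inverted.\<close>
      have cH: "c * H w > 0" using that beta by (simp add: Q_def c_def)
      have "P w \<longleftrightarrow> log 2 ((1 + c * H w) / (1 + p * ?Z)) < Rs"
        unfolding P_def sum by (simp add: c_def)
      also have "\<dots> \<longleftrightarrow> (1 + c * H w) / (1 + p * ?Z) < 2 powr Rs"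
        using cH Z p by (intro log_less_iff) (auto intro!: divide_pos_pos add_pos_nonneg)
      also have "\<dots> \<longleftrightarrow> 1 + c * H w < 2 powr Rs * (1 + p * ?Z)"
        using Z p by (intro pos_divide_less_eq) (auto intro!: add_pos_nonneg)
      also have "2 powr Rs * (1 + p * ?Z) = 1 + c * (b + q * ?Z)"
        using c p d by (simp add: b_def q_def c_def field_simps)
      finally show ?thesis using c by simp
    qed
    then show ?case unfolding Q_iff by auto
  qed
  have "prob {w \<in> space M. \<not> P w \<and> Q w}
      = prob {w \<in> space M. b < H w \<and> b + q * (\<Sum>k. S k w / dist (X k w) T powr alpha) \<le> H w}"
    using PQ_iff by (intro prob_eq_AE) auto
  also note secrecy_success_joint[OF X lam H S indS ind indH alpha b q, of T]
  finally have joint: "prob {w \<in> space M. \<not> P w \<and> Q w}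
     = exp (- b) * exp (- (pi * lam * Gamma (1 + 2 / alpha) * Gamma (1 - 2 / alpha) * q powr (2 / alpha)))" .
  have pQ: "prob {w \<in> space M. Q w} = exp (- b)"
    unfolding Q_iff using exponential_distributedD_gt[OF H b] by simp
  have "prob {w \<in> space M. Q w} = prob ({w \<in> space M. P w \<and> Q w} \<union> {w \<in> space M. \<not> P w \<and> Q w})"
    by (rule arg_cong[where f=prob]) auto
  also have "\<dots> = prob {w \<in> space M. P w \<and> Q w} + prob {w \<in> space M. \<not> P w \<and> Q w}"
    by (rule finite_measure_Union) auto
  finally have split: "prob {w \<in> space M. Q w} = prob {w \<in> space M. P w \<and> Q w} + prob {w \<in> space M. \<not> P w \<and> Q w}" .
  have ratio: "1 - u / x = v / x" if "x = u + v" "x \<noteq> 0" for u v x :: real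
    using that by (simp add: field_simps)
  have "1 - cond_prob M P Q = prob {w \<in> space M. \<not> P w \<and> Q w} / prob {w \<in> space M. Q w}"
    unfolding cond_prob_def by (rule ratio[OF split]) (simp add: pQ)
  also have "\<dots> = exp (- (pi * lam * Gamma (1 + 2 / alpha) * Gamma (1 - 2 / alpha) * q powr (2 / alpha)))"
    unfolding joint pQ by simp
  \<comment> \<open>The power 2/alpha turns d^alpha into the squared hop length and 2^Rs into the
    rate factor of the final formula.\<close>
  also have "q powr (2 / alpha) = 2 powr (2 * Rs / alpha) * d\<^sup>2"
    using alpha d by (simp add: q_def powr_mult powr_powr mult.commute)
  finally show ?thesis
    by (simp add: P_def[abs_def] Q_def[abs_def] mult.assoc)
qed

theorem theorem1:
  fixes M :: "'a measure"
    and alpha lam Rs :: real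
    and N :: nat
    and p D :: "nat \<Rightarrow> real"
    and T :: "nat \<Rightarrow> point"
    and H :: "nat \<Rightarrow> 'a \<Rightarrow> real"
    and X :: "nat \<Rightarrow> nat \<Rightarrow> 'a \<Rightarrow> point"
    and S :: "nat \<Rightarrow> nat \<Rightarrow> 'a \<Rightarrow> real"
  assumes "prob_space M"
    and "alpha > 2" and "lam > 0" and "Rs > 0"
    and "\<And>n. n \<in> {1..N} \<Longrightarrow> p n > 0"
    and "\<And>n. n \<in> {1..N} \<Longrightarrow> D n > 0"
    and "\<And>n. n \<in> {1..N} \<Longrightarrow> distributed M lborel (H n) (exponential_density 1)"
    and "\<And>n k. n \<in> {1..N} \<Longrightarrow> distributed M lborel (S n k) (exponential_density 1)"
    and "\<And>n. n \<in> {1..N} \<Longrightarrow> homogeneous_PPP M lam (X n)"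
    and "\<And>n. n \<in> {1..N} \<Longrightarrow>
           prob_space.indep_vars M (\<lambda>_. borel) (\<lambda>k w. S n k w) UNIV"
    and "\<And>n. n \<in> {1..N} \<Longrightarrow>
           indep_rv2 M (Pi\<^sub>M UNIV (\<lambda>_. borel)) (\<lambda>w k. X n k w)
                                  (Pi\<^sub>M UNIV (\<lambda>_. borel)) (\<lambda>w k. S n k w)"
    and "\<And>n. n \<in> {1..N} \<Longrightarrow>
           indep_rv2 M borel (H n)
             (Pi\<^sub>M UNIV (\<lambda>_. borel) \<Otimes>\<^sub>M Pi\<^sub>M UNIV (\<lambda>_. borel))
             (\<lambda>w. ((\<lambda>k. X n k w), (\<lambda>k. S n k w)))"
    and "prob_space.indep_vars M
           (\<lambda>_. borel \<Otimes>\<^sub>M (Pi\<^sub>M UNIV (\<lambda>_. borel) \<Otimes>\<^sub>M Pi\<^sub>M UNIV (\<lambda>_. borel)))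
           (\<lambda>n w. (H n w, (\<lambda>k. X n k w), (\<lambda>k. S n k w))) {1..N}"
  shows
    "(let beta_t = 2 powr Rs - 1;
          SNR = (\<lambda>n w. p n * H n w / D n powr alpha);
          SNRsum = (\<lambda>n w. \<Sum>k. p n * S n k w / dist (X n k w) (T n) powr alpha);
          Pso' = (\<lambda>n. cond_prob M
                    (\<lambda>w. log 2 ((1 + SNR n w) / (1 + SNRsum n w)) < Rs)
                    (\<lambda>w. SNR n w > beta_t));
          Pso = 1 - (\<Prod>n\<in>{1..N}. 1 - Pso' n);
          K1 = pi * lam * Gamma (1 + 2 / alpha) * Gamma (1 - 2 / alpha)
      in Pso = 1 - exp (- K1 * 2 powr (2 * Rs / alpha) * (\<Sum>n\<in>{1..N}. (D n)\<^sup>2)))"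
proof -
  interpret prob_space M by fact
  define K where "K = pi * lam * Gamma (1 + 2 / alpha) * Gamma (1 - 2 / alpha) * 2 powr (2 * Rs / alpha)"
  have hop: "1 - cond_prob M
      (\<lambda>w. log 2 ((1 + p n * H n w / D n powr alpha) / (1 + (\<Sum>k. p n * S n k w / dist (X n k w) (T n) powr alpha))) < Rs)
      (\<lambda>w. p n * H n w / D n powr alpha > 2 powr Rs - 1) = exp (- (K * (D n)\<^sup>2))" if "n \<in> {1..N}" for n
    unfolding K_def
    by (rule hop_secrecy_success[OF assms(9)[OF that] assms(3) assms(7)[OF that] assms(8)[OF that]
          assms(10)[OF that] assms(11)[OF that] assms(12)[OF that] assms(2) assms(4)
          assms(5)[OF that] assms(6)[OF that]])
  \<comment> \<open>The end-to-end outage is one minus the product of the hop success probabilities,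
    so their exponents add up to the sum of squared hop lengths.\<close>
  have "(\<Prod>n\<in>{1..N}. exp (- (K * (D n)\<^sup>2))) = exp (- K * (\<Sum>n\<in>{1..N}. (D n)\<^sup>2))"
    by (simp add: sum_distrib_left sum_negf flip: exp_sum)
  with prod.cong[OF refl hop, of "{1..N}"] show ?thesis
    unfolding Let_def K_def by (simp only: minus_mult_left)
qed

end
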